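(* Let $r$ be a positive integer. There are polynomials $c_{r,k}(x)\in\mathbb{Q}[x]$ ($0\le k\le r$), depending only on $r$ and $k$ and each of degree at most $r$, such that for every integer $n\ge 2r+2$, $$\sum_{k=r+1}^{n-r-1}\zeta(2k,2n-2k)\prod_{\alpha=1}^{r}\big\{(2k-\alpha)(2n-2k-\alpha)\big\}=c_{r,0}(n)\,\zeta(2n)+\sum_{k=1}^{r}c_{r,k}(n)\,\zeta(2k)\zeta(2n-2k).$$ More precisely, $c_{r,k}=0$ for $1\le k\le\lceil r/2\rceil$, $$c_{r,0}(n)=(r!)^2\left(\frac{(-1)^r}{2}\binom{2n-1}{r}+\frac14\varphi_r(n)\right),$$ and for $\lceil r/2\rceil<k\le r$, $$c_{r,k}(n)=-\prod_{\alpha=1}^{r}(2k-\alpha)\prod_{\beta=2k+1}^{2r+1}(2n-\beta)\left\{\frac{(-1)^r r!}{(2r-2k+1)!}+\frac{(2n-2r-2)!}{(2n-2k-r-1)!}\right\}.$$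
   Context: $\zeta$ is the Riemann zeta function and $\zeta(a,b)=\sum_{m_1>m_2>0}m_1^{-a}m_2^{-b}$ is the double zeta value. Here $\varphi_r(n)=(-1)^r\binom{n-1}{r}+4\sum_{k=1}^{r}\binom{2k-1}{r}\binom{2n-2k-1}{r}$, which for $n\ge 2r+1$ also equals $\binom{2n-1}{2r+1}-2\sum_{k=r+1}^{n-r-1}\binom{2k-1}{r}\binom{2n-2k-1}{r}$. Binomial coefficients $\binom{a}{b}$ vanish for $b<0$ or $b>a$; empty products are $1$. *)

theory Defs
  imports
    "HOL-Analysis.Analysis"
    "HOL-Computational_Algebra.Polynomial"
begin

text \<open>The Riemann zeta function at integers \<open>s \<ge> 2\<close>, where its Dirichlet series converges.\<close>

definition zeta :: "nat \<Rightarrow> real" where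
  "zeta s = (\<Sum>m. 1 / real (Suc m) ^ s)"

text \<open>
  The defining family is summable for \<open>a \<ge> 2\<close> and \<open>b \<ge> 1\<close>; outside this range \<open>infsum\<close>
  returns a junk value.
\<close>

definition double_zeta :: "nat \<Rightarrow> nat \<Rightarrow> real" where
  "double_zeta a b =
     (\<Sum>\<^sub>\<infinity>(m\<^sub>1, m\<^sub>2) \<in> {(m\<^sub>1, m\<^sub>2). m\<^sub>1 > m\<^sub>2 \<and> m\<^sub>2 > 0}. 1 / (real m\<^sub>1 ^ a * real m\<^sub>2 ^ b))"

text \<open>
  For \<open>r \<ge> 1\<close> the truncated subtractions are harmless: a negative upper argument becomes \<open>0\<close>,
  and the binomial coefficient vanishes either way.
\<close>

definition phi :: "nat \<Rightarrow> nat \<Rightarrow> rat" where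
  "phi r n = (-1) ^ r * of_nat ((n - 1) choose r)
     + 4 * (\<Sum>k=1..r. of_nat ((2 * k - 1) choose r) * of_nat ((2 * n - 2 * k - 1) choose r))"

end

theory Submission
  imports Defs "HOL-Computational_Algebra.Formal_Laurent_Series"
begin

unbundle fps_syntax

text \<open>
  The weight is \<open>(r!)\<^sup>2\<close> times \<open>f k = binom(2k-1, r) * binom(2n-2k-1, r)\<close>, which is symmetric under
  \<open>k \<mapsto> n - k\<close>; by the harmonic product, twice the weighted double zeta sum is therefore
  \<open>(r!)\<^sup>2\<close> times the sum of \<open>f k * (zeta (2k) * zeta (2n-2k) - zeta (2n))\<close>.
  The first part is a coefficient of the square of \<open>H r = g\<^sup>(\<^sup>r\<^sup>) / r!\<close>, where
  \<open>g = - 1/(2X) + (\<Sum>k. zeta (2k) * X ^ (2k-1)) = - (pi/2) * cot (pi * X)\<close>. Euler's convolution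
  formula for even zeta values says that \<open>g\<close> satisfies a Riccati equation, so every polynomial in the
  derivatives of \<open>g\<close> is a polynomial in \<open>g\<close>, and such a polynomial is constant as soon as it has no
  pole. Comparing principal parts expresses \<open>(H r)\<^sup>2\<close> as a linear combination of the
  \<open>H (2r+1-2k)\<close> with coefficients proportional to \<open>zeta (2k)\<close>.
\<close>

section \<open>Zeta values\<close>

lemma zeta_sums: "2 \<le> s \<Longrightarrow> (\<lambda>m. 1 / real (Suc m) ^ s) sums zeta s"
  unfolding zeta_def
  using inverse_power_summable[of s, where 'a = real]
    summable_Suc_iff[of "\<lambda>n. inverse (real n ^ s)"]
  by (intro summable_sums) (simp add: inverse_eq_divide)

lemma zeta_partial_sums_LIMSEQ:
  assumes "2 \<le> s"
  shows "(\<lambda>M. \<Sum>a=1..M. 1 / real a ^ s) \<longlonglongrightarrow> zeta s"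
  using zeta_sums[OF assms] by (simp add: sums_def sum.atLeast1_atMost_eq)

lemma zeta_has_sum:
  assumes "2 \<le> s"
  shows "((\<lambda>m. 1 / real m ^ s) has_sum zeta s) {0<..}"
proof -
  have "((\<lambda>m. 1 / real (Suc m) ^ s) has_sum zeta s) UNIV"
    by (rule sums_nonneg_imp_has_sum[OF zeta_sums[OF assms]]) simp
  moreover have "{0<..} = range Suc"
    using greaterThan_0 by simp
  ultimately show ?thesis
    using has_sum_reindex[of Suc UNIV "\<lambda>m. 1 / real m ^ s" "zeta s"] by (simp add: o_def)
qed

text \<open>The harmonic product: the absolutely convergent double series over the positive quadrant
  is cut into the regions below, above and on the diagonal.\<close>

lemma zeta_mult_zeta_eq_double_zeta:
  assumes "2 \<le> a" "2 \<le> b"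
  shows "zeta a * zeta b = double_zeta a b + double_zeta b a + zeta (a + b)"
proof -
  define f where "f = (\<lambda>(m, n). 1 / (real m ^ a * real n ^ b))"
  define G L D :: "(nat \<times> nat) set" where
    "G = {(m, n). m > n \<and> n > 0}" and "L = {(m, n). n > m \<and> m > 0}" and
    "D = (\<lambda>m. (m, m)) ` {0<..}"
  have inner: "((\<lambda>n. f (m, n)) has_sum 1 / real m ^ a * zeta b) {0<..}" for m
    using has_sum_cmult_right[OF zeta_has_sum[OF assms(2)], of "1 / real m ^ a"]
    by (simp add: f_def)
  have outer: "((\<lambda>m. 1 / real m ^ a * zeta b) has_sum zeta a * zeta b) {0<..}"
    by (rule has_sum_cmult_left[OF zeta_has_sum[OF assms(1)]])
  have summ: "f summable_on {0<..} \<times> {0<..}"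
    by (rule summable_on_SigmaI[OF inner has_sum_imp_summable[OF outer]]) (auto simp: f_def)
  have total: "(f has_sum zeta a * zeta b) ({0<..} \<times> {0<..})"
    by (rule has_sum_SigmaI[OF inner outer summ])
  have split: "{0<..} \<times> {0<..} = G \<union> L \<union> D"
    by (auto simp: G_def L_def D_def)
  have disj: "G \<inter> L = {}" "(G \<union> L) \<inter> D = {}"
    by (auto simp: G_def L_def D_def)
  have [simp]: "f summable_on G" "f summable_on L" "f summable_on D"
    using summable_on_subset[OF summ] unfolding split by auto
  have "zeta a * zeta b = infsum f (G \<union> L \<union> D)"
    using total split by (metis infsumI)
  also have "\<dots> = infsum f (G \<union> L) + infsum f D"
    by (intro infsum_Un_disjoint summable_on_Un_disjoint disj) simp_all
  also have "infsum f (G \<union> L) = infsum f G + infsum f L"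
    by (intro infsum_Un_disjoint disj) simp_all
  also have "infsum f G = double_zeta a b"
    by (simp add: f_def G_def double_zeta_def)
  also have "infsum f L = double_zeta b a"
    unfolding double_zeta_def
    by (rule infsum_reindex_bij_witness[of _ prod.swap prod.swap])
       (auto simp: f_def L_def mult.commute)
  also have "infsum f D = zeta (a + b)"
  proof -
    have "infsum f D = infsum (\<lambda>m. 1 / real m ^ (a + b)) {0<..}"
      unfolding D_def by (subst infsum_reindex) (auto simp: inj_on_def f_def o_def power_add)
    also have "\<dots> = zeta (a + b)"
      using assms by (intro infsumI zeta_has_sum) simp
    finally show ?thesis .
  qed
  finally show ?thesis .
qed

section \<open>Euler's convolution formula for even zeta values, through truncated sums\<close>

lemma sum_inverse_shift_eq_harm: "(\<Sum>b=1..M. 1 / (real b + real a)) = harm (M + a) - harm a"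
  by (induction M) (simp_all add: harm_Suc inverse_eq_divide add_ac)

text \<open>Terms with \<open>b > a\<close> contribute \<open>harm (M - a)\<close>; those with
  \<open>b < a\<close> are the negated reciprocals of \<open>1, ..., a - 1\<close>. The induction
  starts at \<open>M = a\<close>, where only the latter are present.\<close>

lemma sum_inverse_diff_eq_harm:
  assumes "1 \<le> a" "a \<le> M"
  shows "(\<Sum>b\<in>{1..M} - {a}. 1 / (real b - real a)) = harm (M - a) - harm (a - 1)"
  using assms(2)
proof (induction M rule: dec_induct)
  case base
  have "(\<Sum>b\<in>{1..a} - {a}. 1 / (real b - real a)) = (\<Sum>k=1..a-1. - inverse (real k))"
    by (rule sum.reindex_bij_witness[of _ "\<lambda>k. a - k" "\<lambda>b. a - b"])
       (auto simp: of_nat_diff field_simps)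
  then show ?case
    by (simp add: harm_def sum_negf)
next
  case (step M)
  have "{1..Suc M} - {a} = insert (Suc M) ({1..M} - {a})"
    using step.hyps by auto
  then show ?case
    using step by (simp add: Suc_diff_le harm_Suc of_nat_diff inverse_eq_divide)
qed

text \<open>Partial fractions in \<open>b - a\<close> and \<open>b + a\<close>. The constant
  \<open>3/4\<close> collects two corrections: \<open>1/(2a)\<close> from the omitted term
  \<open>b = a\<close> of the second sum, and \<open>1/a\<close> from
  \<open>harm a - harm (a - 1)\<close>.\<close>

lemma sum_inverse_square_diff:
  assumes "1 \<le> a" "a \<le> M"
  shows "(\<Sum>b\<in>{1..M} - {a}. 1 / (real b ^ 2 - real a ^ 2))
    = 3 / (4 * real a ^ 2) - (harm (M + a) - harm (M - a)) / (2 * real a)"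
proof -
  have "(\<Sum>b\<in>{1..M} - {a}. 1 / (real b ^ 2 - real a ^ 2))
      = (\<Sum>b\<in>{1..M} - {a}. (1 / (real b - real a) - 1 / (real b + real a)) / (2 * real a))"
  proof (rule sum.cong)
    fix b assume "b \<in> {1..M} - {a}"
    then have "real b - real a \<noteq> 0" "real b + real a \<noteq> 0" "real a \<noteq> 0"
      using assms by auto
    moreover have "real b ^ 2 - real a ^ 2 = (real b - real a) * (real b + real a)"
      by (simp add: power2_eq_square algebra_simps)
    ultimately show "1 / (real b ^ 2 - real a ^ 2)
        = (1 / (real b - real a) - 1 / (real b + real a)) / (2 * real a)"
      by (simp add: divide_simps)
  qed simp
  also have "\<dots> = ((\<Sum>b\<in>{1..M} - {a}. 1 / (real b - real a))
      - (\<Sum>b\<in>{1..M} - {a}. 1 / (real b + real a))) / (2 * real a)"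
    by (simp only: sum_subtractf flip: sum_divide_distrib)
  also have "(\<Sum>b\<in>{1..M} - {a}. 1 / (real b + real a)) = harm (M + a) - harm a - 1 / (2 * real a)"
    using assms by (subst sum_diff1) (auto simp: sum_inverse_shift_eq_harm[simplified])
  also have "harm a = harm (a - 1) + 1 / real a"
    using assms harm_Suc[of "a - 1", where 'a = real] by (simp add: inverse_eq_divide)
  also have "((\<Sum>b\<in>{1..M} - {a}. 1 / (real b - real a))
      - (harm (M + a) - (harm (a - 1) + 1 / real a) - 1 / (2 * real a))) / (2 * real a)
      = 3 / (4 * real a ^ 2) - (harm (M + a) - harm (M - a)) / (2 * real a)"
  proof -
    have "(x - y - (t - (y + 1 / real a) - 1 / (2 * real a))) / (2 * real a)
        = 3 / (4 * real a ^ 2) - (t - x) / (2 * real a)" for x y t :: real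
      using assms by (simp add: field_simps power2_eq_square)
    then show ?thesis
      unfolding sum_inverse_diff_eq_harm[OF assms] .
  qed
  finally show ?thesis .
qed

lemma harm_diff_le:
  assumes "m \<le> n"
  shows "harm n - harm m \<le> (real n - real m) / (real m + 1)"
  using assms
proof (induction n rule: dec_induct)
  case (step n)
  have "inverse (real (Suc n)) \<le> 1 / (real m + 1)"
    using step.hyps by (simp add: field_simps)
  then show ?case
    using step.IH by (simp add: harm_Suc add_divide_distrib diff_divide_distrib)
qed simp

lemma harm_over_n_LIMSEQ: "(\<lambda>n. harm n / real n :: real) \<longlonglongrightarrow> 0"
proof -
  have "(\<lambda>n. (harm n - ln (real n)) * inverse (real n) + ln (real n) / real n) \<longlonglongrightarrow>
      euler_mascheroni * 0 + 0"
    by (intro tendsto_intros euler_mascheroni_LIMSEQ LIMSEQ_inverse_real_of_nat lim_inverse_n)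
  then show ?thesis
    by (simp add: diff_divide_distrib flip: divide_inverse)
qed

text \<open>A finite geometric sum in \<open>u = 1/a^2\<close> and \<open>v = 1/b^2\<close>: since
  \<open>u - v = u * v * (b^2 - a^2)\<close>, the factor \<open>u * v\<close> cancels when
  \<open>u^(n-1) - v^(n-1)\<close> is factored.\<close>

lemma sum_power_mult_power_diff:
  fixes a b :: real
  assumes "a \<noteq> 0" "b \<noteq> 0" "a ^ 2 \<noteq> b ^ 2" "2 \<le> n"
  shows "(\<Sum>k=1..n-1. 1 / a ^ (2 * k) * (1 / b ^ (2 * n - 2 * k)))
    = (1 / a ^ (2 * n - 2) - 1 / b ^ (2 * n - 2)) / (b ^ 2 - a ^ 2)"
proof -
  obtain m where n: "n = Suc (Suc m)"
    using assms(4) by (metis Suc_le_D numeral_2_eq_2 Suc_le_mono)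
  define u v where "u = 1 / a ^ 2" and "v = 1 / b ^ 2"
  have "(\<Sum>k=1..n-1. 1 / a ^ (2 * k) * (1 / b ^ (2 * n - 2 * k)))
      = (\<Sum>k=1..n-1. u ^ k * v ^ (n - k))"
    by (simp add: u_def v_def power_one_over flip: power_mult diff_mult_distrib2)
  also have "\<dots> = (\<Sum>p<Suc m. u ^ Suc p * v ^ (Suc (Suc m) - Suc p))"
    using sum.atLeast1_atMost_eq[of "\<lambda>k. u ^ k * v ^ (n - k)" "Suc m"] by (simp add: n)
  also have "\<dots> = (\<Sum>p<Suc m. (u * v) * (u ^ p * v ^ (m - p)))"
    by (rule sum.cong) (auto simp: Suc_diff_le)
  also have "\<dots> = (u * v) * (\<Sum>p<Suc m. u ^ p * v ^ (m - p))"
    by (simp only: sum_distrib_left)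
  finally have *: "(\<Sum>k=1..n-1. 1 / a ^ (2 * k) * (1 / b ^ (2 * n - 2 * k)))
      = (u * v) * (\<Sum>p<Suc m. u ^ p * v ^ (m - p))" .
  have d: "u - v = (u * v) * (b ^ 2 - a ^ 2)"
    using assms by (simp add: u_def v_def field_simps)
  have "u ^ Suc m - v ^ Suc m
      = (b ^ 2 - a ^ 2) * ((u * v) * (\<Sum>p<Suc m. u ^ p * v ^ (m - p)))"
    unfolding diff_power_eq_sum d by (simp only: mult_ac)
  moreover have "u ^ Suc m = 1 / a ^ (2 * n - 2)" "v ^ Suc m = 1 / b ^ (2 * n - 2)"
    by (simp_all add: u_def v_def n power_one_over power2_eq_square power_mult_distrib
        flip: power_mult mult_2)
       (simp_all add: power_mult power2_eq_square power_mult_distrib power_add)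
  ultimately have "1 / a ^ (2 * n - 2) - 1 / b ^ (2 * n - 2)
      = (b ^ 2 - a ^ 2) * ((u * v) * (\<Sum>p<Suc m. u ^ p * v ^ (m - p)))"
    by (simp only:)
  then show ?thesis
    unfolding * using assms(3) by simp
qed

text \<open>Exchanging the names \<open>a\<close> and \<open>b\<close> reverses the sign of the
  denominator, so both halves of the numerator contribute equally.\<close>

lemma sum_offdiag_antisym:
  fixes w :: "nat \<Rightarrow> real"
  shows "(\<Sum>a=1..M. \<Sum>b\<in>{1..M} - {a}. (w a - w b) / (real b ^ 2 - real a ^ 2))
    = 2 * (\<Sum>a=1..M. w a * (\<Sum>b\<in>{1..M} - {a}. 1 / (real b ^ 2 - real a ^ 2)))"
proof -
  have *: "{1..M} - {a} = {b. b \<in> {1..M} \<and> a \<noteq> b}" for a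
    by auto
  have "(\<Sum>a=1..M. \<Sum>b\<in>{1..M} - {a}. w b * (1 / (real b ^ 2 - real a ^ 2)))
      = (\<Sum>b=1..M. \<Sum>a | a \<in> {1..M} \<and> a \<noteq> b. w b * (1 / (real b ^ 2 - real a ^ 2)))"
    unfolding * by (rule sum.swap_restrict) auto
  also have "\<dots> = (\<Sum>b=1..M. \<Sum>a\<in>{1..M} - {b}. - (w b * (1 / (real a ^ 2 - real b ^ 2))))"
    by (intro sum.cong) (auto simp: minus_divide_right)
  finally have "(\<Sum>a=1..M. \<Sum>b\<in>{1..M} - {a}. w b * (1 / (real b ^ 2 - real a ^ 2)))
      = - (\<Sum>a=1..M. w a * (\<Sum>b\<in>{1..M} - {a}. 1 / (real b ^ 2 - real a ^ 2)))"
    by (simp add: sum_negf sum_distrib_left)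
  moreover have "(\<Sum>a=1..M. \<Sum>b\<in>{1..M} - {a}. (w a - w b) / (real b ^ 2 - real a ^ 2))
      = (\<Sum>a=1..M. w a * (\<Sum>b\<in>{1..M} - {a}. 1 / (real b ^ 2 - real a ^ 2)))
        - (\<Sum>a=1..M. \<Sum>b\<in>{1..M} - {a}. w b * (1 / (real b ^ 2 - real a ^ 2)))"
    by (simp add: sum_distrib_left diff_divide_distrib sum_subtractf)
  ultimately show ?thesis by simp
qed

text \<open>Expand the products and sum over \<open>k\<close> first. Diagonal pairs
  \<open>a = b\<close> contribute \<open>n - 1\<close> copies of \<open>1/a^(2n)\<close>.
  Off-diagonal pairs give geometric sums, which antisymmetry reduces to
  \<open>sum_inverse_square_diff\<close>; that supplies the remaining \<open>3/2\<close> and the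
  harmonic error term.\<close>

lemma sum_zeta_partial_sums:
  assumes "2 \<le> n"
  shows "(\<Sum>k=1..n-1. (\<Sum>a=1..M. 1 / real a ^ (2 * k)) * (\<Sum>b=1..M. 1 / real b ^ (2 * n - 2 * k)))
    = (real n + 1 / 2) * (\<Sum>a=1..M. 1 / real a ^ (2 * n))
      - (\<Sum>a=1..M. (harm (M + a) - harm (M - a)) / real a ^ (2 * n - 1))"
proof -
  define S where "S a b = (\<Sum>k=1..n-1. 1 / real a ^ (2 * k) * (1 / real b ^ (2 * n - 2 * k)))" for a b
  define w where "w a = 1 / real a ^ (2 * n - 2)" for a
  have "(\<Sum>k=1..n-1. (\<Sum>a=1..M. 1 / real a ^ (2 * k)) * (\<Sum>b=1..M. 1 / real b ^ (2 * n - 2 * k)))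
      = (\<Sum>a=1..M. \<Sum>b=1..M. S a b)"
    unfolding S_def sum_product
    by (subst sum.swap) (rule sum.cong[OF refl], rule sum.swap)
  also have "\<dots> = (\<Sum>a=1..M. S a a + (\<Sum>b\<in>{1..M} - {a}. S a b))"
    by (intro sum.cong) (auto intro: sum.remove)
  also have "\<dots> = (\<Sum>a=1..M. S a a) + (\<Sum>a=1..M. \<Sum>b\<in>{1..M} - {a}. S a b)"
    by (rule sum.distrib)
  also have "(\<Sum>a=1..M. S a a) = (\<Sum>a=1..M. (real n - 1) * (1 / real a ^ (2 * n)))"
  proof (rule sum.cong)
    fix a assume "a \<in> {1..M}"
    have "S a a = (\<Sum>k=1..n-1. 1 / real a ^ (2 * n))"
      unfolding S_def by (intro sum.cong) (auto simp flip: power_add)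
    then show "S a a = (real n - 1) * (1 / real a ^ (2 * n))"
      using assms by (simp add: of_nat_diff)
  qed simp
  also have "(\<Sum>a=1..M. \<Sum>b\<in>{1..M} - {a}. S a b)
      = (\<Sum>a=1..M. \<Sum>b\<in>{1..M} - {a}. (w a - w b) / (real b ^ 2 - real a ^ 2))"
    unfolding S_def w_def
    by (intro sum.cong refl sum_power_mult_power_diff assms) (auto simp: power2_eq_iff)
  also have "\<dots> = 2 * (\<Sum>a=1..M. w a * (\<Sum>b\<in>{1..M} - {a}. 1 / (real b ^ 2 - real a ^ 2)))"
    by (rule sum_offdiag_antisym)
  also have "\<dots> = (\<Sum>a=1..M. 3 / 2 * (1 / real a ^ (2 * n))
      - (harm (M + a) - harm (M - a)) / real a ^ (2 * n - 1))"
  proof (subst sum_distrib_left, rule sum.cong)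
    fix a assume a: "a \<in> {1..M}"
    have e: "2 * n = (2 * n - 2) + 2" "2 * n - 1 = (2 * n - 2) + 1"
      using assms by auto
    have p: "real a ^ (2 * n) = real a ^ (2 * n - 2) * real a ^ 2"
      "real a ^ (2 * n - 1) = real a ^ (2 * n - 2) * real a"
      by (subst e, simp only: power_add power_one_right)+
    show "2 * (w a * (\<Sum>b\<in>{1..M} - {a}. 1 / (real b ^ 2 - real a ^ 2)))
        = 3 / 2 * (1 / real a ^ (2 * n)) - (harm (M + a) - harm (M - a)) / real a ^ (2 * n - 1)"
      using a sum_inverse_square_diff[of a M] unfolding w_def p
      by (simp add: field_simps power2_eq_square)
  qed simp
  finally show ?thesis
    by (simp only: sum_subtractf flip: sum_distrib_left) (simp add: algebra_simps)
qed

text \<open>As \<open>2 * n - 1 >= 2\<close>, each term is at most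
  \<open>2 / (a * (M - a + 1))\<close>. Splitting this bound into \<open>1/a\<close> and
  \<open>1/(M + 1 - a)\<close>, both with factor \<open>2/(M + 1)\<close>, bounds the sum by
  \<open>4 * harm M / M\<close>.\<close>

lemma harm_error_term_LIMSEQ:
  assumes "2 \<le> n"
  shows "(\<lambda>M. \<Sum>a=1..M. (harm (M + a) - harm (M - a)) / real a ^ (2 * n - 1)) \<longlonglongrightarrow> 0"
proof (rule tendsto_sandwich[OF _ _ tendsto_const])
  show "\<forall>\<^sub>F M in sequentially. 0 \<le> (\<Sum>a=1..M. (harm (M + a) - harm (M - a)) / real a ^ (2 * n - 1))"
    by (intro always_eventually allI sum_nonneg divide_nonneg_nonneg) (auto intro!: harm_mono)
  show "\<forall>\<^sub>F M in sequentially.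
      (\<Sum>a=1..M. (harm (M + a) - harm (M - a)) / real a ^ (2 * n - 1)) \<le> 4 * (harm M / real M)"
  proof (rule eventually_mono[OF eventually_gt_at_top[of 0]])
    fix M :: nat assume M: "0 < M"
    have "(\<Sum>a=1..M. (harm (M + a) - harm (M - a)) / real a ^ (2 * n - 1))
        \<le> (\<Sum>a=1..M. 2 / (real M + 1) * (1 / real a + 1 / real (M + 1 - a)))"
    proof (rule sum_mono)
      fix a assume a: "a \<in> {1..M}"
      have h: "harm (M + a) - harm (M - a) \<le> 2 * real a / (real M - real a + 1)"
        using harm_diff_le[of "M - a" "M + a"] a by (simp add: of_nat_diff)
      have "real a ^ 2 \<le> real a ^ (2 * n - 1)"
        using a assms by (intro power_increasing) auto
      then have "(harm (M + a) - harm (M - a)) / real a ^ (2 * n - 1)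
          \<le> (2 * real a / (real M - real a + 1)) / real a ^ 2"
        using a h by (intro frac_le) auto
      also have "\<dots> = 2 / (real M + 1) * (1 / real a + 1 / real (M + 1 - a))"
      proof -
        have "real a > 0" "real M - real a + 1 > 0" "real (M + 1 - a) = real M - real a + 1"
          using a by (auto simp: of_nat_diff)
        then show ?thesis
          by (simp add: divide_simps power2_eq_square) (simp add: algebra_simps)
      qed
      finally show "(harm (M + a) - harm (M - a)) / real a ^ (2 * n - 1)
          \<le> 2 / (real M + 1) * (1 / real a + 1 / real (M + 1 - a))" .
    qed
    also have "\<dots> = 2 / (real M + 1) * ((\<Sum>a=1..M. 1 / real a) + (\<Sum>a=1..M. 1 / real (M + 1 - a)))"
      by (simp only: sum.distrib flip: sum_distrib_left)
    also have "(\<Sum>a=1..M. 1 / real (M + 1 - a)) = (\<Sum>a=1..M. 1 / real a)"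
      by (rule sum.reindex_bij_witness[of _ "\<lambda>a. M + 1 - a" "\<lambda>a. M + 1 - a"]) auto
    also have "(\<Sum>a=1..M. 1 / real a) = harm M"
      by (simp add: harm_def inverse_eq_divide)
    also have "2 / (real M + 1) * (harm M + harm M) = 4 * (harm M / (real M + 1))"
      by simp
    also have "\<dots> \<le> 4 * (harm M / real M)"
      using M by (intro mult_left_mono divide_left_mono) (auto simp: harm_nonneg)
    finally show "(\<Sum>a=1..M. (harm (M + a) - harm (M - a)) / real a ^ (2 * n - 1))
        \<le> 4 * (harm M / real M)" .
  qed
  show "(\<lambda>M. 4 * (harm M / real M) :: real) \<longlonglongrightarrow> 0"
    using tendsto_mult_right_zero[OF harm_over_n_LIMSEQ, of 4] by simp
qed

text \<open>Cutting both zeta factors off at the same \<open>M\<close> keeps every rearrangement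
  finite; the limit is taken only in the exact truncated identity.\<close>

theorem sum_zeta_even_mult_zeta_even:
  assumes "2 \<le> n"
  shows "(\<Sum>k=1..n-1. zeta (2 * k) * zeta (2 * n - 2 * k)) = (real n + 1 / 2) * zeta (2 * n)"
proof (rule LIMSEQ_unique)
  show "(\<lambda>M. \<Sum>k=1..n-1. (\<Sum>a=1..M. 1 / real a ^ (2 * k)) * (\<Sum>b=1..M. 1 / real b ^ (2 * n - 2 * k)))
      \<longlonglongrightarrow> (\<Sum>k=1..n-1. zeta (2 * k) * zeta (2 * n - 2 * k))"
    by (intro tendsto_sum tendsto_mult zeta_partial_sums_LIMSEQ) auto
  have "(\<lambda>M. (real n + 1 / 2) * (\<Sum>a=1..M. 1 / real a ^ (2 * n))
      - (\<Sum>a=1..M. (harm (M + a) - harm (M - a)) / real a ^ (2 * n - 1)))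
      \<longlonglongrightarrow> (real n + 1 / 2) * zeta (2 * n) - 0"
    using assms by (intro tendsto_diff tendsto_mult tendsto_const zeta_partial_sums_LIMSEQ
        harm_error_term_LIMSEQ) auto
  then show "(\<lambda>M. \<Sum>k=1..n-1. (\<Sum>a=1..M. 1 / real a ^ (2 * k)) * (\<Sum>b=1..M. 1 / real b ^ (2 * n - 2 * k)))
      \<longlonglongrightarrow> (real n + 1 / 2) * zeta (2 * n)"
    by (simp only: sum_zeta_partial_sums[OF assms] diff_zero)
qed

section \<open>Convolutions of binomial coefficients\<close>

text \<open>Counts the subsets of \<open>{0..N}\<close> of size \<open>r + s + 1\<close> by their
  element \<open>j\<close> with exactly \<open>r\<close> smaller members. The induction uses
  Pascal's rule on the second factor.\<close>

lemma sum_choose_mult_choose: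
  "(\<Sum>j\<le>N. (j choose r) * ((N - j) choose s)) = Suc N choose (r + s + 1)"
proof (induction N arbitrary: s)
  case 0
  then show ?case by (cases r; cases s) auto
next
  case (Suc N)
  show ?case
  proof (cases s)
    case 0
    then show ?thesis by (simp add: sum_choose_upper del: sum.atMost_Suc)
  next
    case (Suc t)
    have "(\<Sum>j\<le>Suc N. (j choose r) * ((Suc N - j) choose s))
        = (\<Sum>j\<le>N. (j choose r) * ((N - j) choose t)) + (\<Sum>j\<le>N. (j choose r) * ((N - j) choose s))"
      by (simp add: Suc Suc_diff_le distrib_left sum.distrib)
    then show ?thesis
      by (simp only: Suc.IH) (simp add: Suc)
  qed
qed

text \<open>Half the difference of the plain convolution and this signed one retains exactly the odd
  \<open>j\<close>.\<close>

definition alternating_choose_sum :: "nat \<Rightarrow> nat \<Rightarrow> nat \<Rightarrow> int" where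
  "alternating_choose_sum N r s = (\<Sum>j\<le>N. (-1) ^ j * int (j choose r) * int ((N - j) choose s))"

lemma alternating_choose_sum_rec_right:
  "alternating_choose_sum (Suc N) r (Suc s)
    = alternating_choose_sum N r s + alternating_choose_sum N r (Suc s)"
  by (simp add: alternating_choose_sum_def Suc_diff_le distrib_left sum.distrib)

lemma alternating_choose_sum_rec_left:
  "alternating_choose_sum (Suc N) (Suc r) s
    = - (alternating_choose_sum N r s + alternating_choose_sum N (Suc r) s)"
  unfolding alternating_choose_sum_def
  by (subst sum.atMost_Suc_shift) (simp add: algebra_simps sum.distrib sum_negf sum_subtractf)

text \<open>In generating functions, \<open>(-x)^r / (1+x)^(r+1)\<close> times
  \<open>x^r / (1-x)^(r+1)\<close> is \<open>(-1)^r x^(2r) / (1-x^2)^(r+1)\<close>. The induction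
  applies Pascal's rule once on each side, and the mixed terms cancel.\<close>

lemma alternating_choose_sum_even:
  "alternating_choose_sum (2 * m) r r = (-1) ^ r * int (m choose r)"
proof (induction m arbitrary: r)
  case 0
  then show ?case by (cases r) (auto simp: alternating_choose_sum_def)
next
  case (Suc m)
  show ?case
  proof (cases r)
    case 0
    have "(\<Sum>j\<le>2 * k. (-1) ^ j) = (1 :: int)" for k
      by (induction k) auto
    from this[of "Suc m"] show ?thesis
      by (simp add: 0 alternating_choose_sum_def del: sum.atMost_Suc)
  next
    case (Suc s)
    have "alternating_choose_sum (2 * Suc m) (Suc s) (Suc s)
        = alternating_choose_sum (2 * m) (Suc s) (Suc s) - alternating_choose_sum (2 * m) s s"
      by (simp add: alternating_choose_sum_rec_right alternating_choose_sum_rec_left[of _ _ s])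
    then show ?thesis
      by (simp only: Suc.IH Suc) (simp add: algebra_simps)
  qed
qed

lemma sum_odd_indices:
  fixes f :: "nat \<Rightarrow> 'a :: comm_monoid_add"
  assumes "\<And>j. j \<le> 2 * n - 2 \<Longrightarrow> even j \<Longrightarrow> f j = 0"
  shows "(\<Sum>j\<le>2 * n - 2. f j) = (\<Sum>k=1..n-1. f (2 * k - 1))"
proof -
  have "(\<Sum>j\<le>2 * n - 2. f j) = (\<Sum>j | j \<le> 2 * n - 2 \<and> odd j. f j)"
    using assms by (intro sum.mono_neutral_right) auto
  also have "\<dots> = (\<Sum>k=1..n-1. f (2 * k - 1))"
    by (rule sum.reindex_bij_witness[of _ "\<lambda>k. 2 * k - 1" "\<lambda>j. (j + 1) div 2"])
       (auto elim!: oddE)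
  finally show ?thesis .
qed

text \<open>Odd indices are isolated by the factor \<open>1 - (-1)^j\<close> in the convolution with
  \<open>N = 2 * n - 2\<close>. This identity connects the two expressions for
  \<open>phi\<close>.\<close>

lemma sum_odd_choose_mult_choose:
  assumes "n \<ge> 1"
  shows "2 * (\<Sum>k=1..n-1. int ((2 * k - 1) choose r) * int ((2 * n - 2 * k - 1) choose r))
    = int ((2 * n - 1) choose (2 * r + 1)) - (-1) ^ r * int ((n - 1) choose r)"
proof -
  define N where "N = 2 * n - 2"
  have N: "N = 2 * (n - 1)" "Suc N = 2 * n - 1"
    using assms by (auto simp: N_def)
  have "int ((2 * n - 1) choose (2 * r + 1)) - (-1) ^ r * int ((n - 1) choose r)
      = (\<Sum>j\<le>N. int (j choose r) * int ((N - j) choose r)) - alternating_choose_sum N r r"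
    using arg_cong[OF sum_choose_mult_choose[where N = N and r = r and s = r], of int]
    unfolding N(1) alternating_choose_sum_even unfolding N(1)[symmetric] N(2)
    by (simp add: mult_2)
  also have "\<dots> = (\<Sum>j\<le>N. (1 - (-1) ^ j) * (int (j choose r) * int ((N - j) choose r)))"
    by (simp add: alternating_choose_sum_def algebra_simps flip: sum_subtractf)
  also have "\<dots> = (\<Sum>k=1..n-1. (1 - (-1) ^ (2 * k - 1))
      * (int ((2 * k - 1) choose r) * int ((N - (2 * k - 1)) choose r)))"
    unfolding N_def by (rule sum_odd_indices) auto
  also have "\<dots> = (\<Sum>k=1..n-1. 2 * (int ((2 * k - 1) choose r) * int ((2 * n - 2 * k - 1) choose r)))"
  proof (rule sum.cong)
    fix k assume "k \<in> {1..n-1}"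
    then have "odd (2 * k - 1)" "N - (2 * k - 1) = 2 * n - 2 * k - 1"
      by (auto simp: N_def)
    then show "(1 - (-1) ^ (2 * k - 1)) * (int ((2 * k - 1) choose r) * int ((N - (2 * k - 1)) choose r))
        = 2 * (int ((2 * k - 1) choose r) * int ((2 * n - 2 * k - 1) choose r))"
      by simp
  qed simp
  finally show ?thesis
    by (simp add: sum_distrib_left)
qed

section \<open>The cotangent series\<close>

text \<open>The falling factorial produced by \<open>r\<close> derivatives is written with
  \<open>gchoose\<close> because exponents of a Laurent series may be negative.\<close>

lemma fls_deriv_iterate_nth:
  fixes f :: "'a :: field_char_0 fls"
  shows "(fls_deriv ^^ r) f $$ m = fact r * (of_int (m + int r) gchoose r) * f $$ (m + int r)"
proof (induction r arbitrary: m)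
  case (Suc r)
  define x :: 'a where "x = of_int (m + 1 + int r)"
  have e: "m + 1 + int r = m + int (Suc r)"
    by simp
  have "(fls_deriv ^^ Suc r) f $$ m = fact r * ((x - of_nat r) * (x gchoose r)) * f $$ (m + 1 + int r)"
    by (simp add: Suc.IH x_def)
  also have "(x - of_nat r) * (x gchoose r) = of_nat (Suc r) * (x gchoose Suc r)"
    using gbinomial_mult_1[of x r] by (simp add: algebra_simps)
  finally show ?case
    unfolding x_def e by (simp add: mult_ac)
qed simp

section \<open>Polynomials evaluated at a Laurent series\<close>

definition poly_fls :: "'a :: field_char_0 poly \<Rightarrow> 'a fls \<Rightarrow> 'a fls" where
  "poly_fls p g = poly (map_poly fls_const p) g"

lemma poly_fls_0 [simp]: "poly_fls 0 g = 0"
  and poly_fls_pCons [simp]: "poly_fls (pCons a p) g = fls_const a + g * poly_fls p g"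
  by (simp_all add: poly_fls_def map_poly_pCons)

lemma poly_fls_add: "poly_fls (p + q) g = poly_fls p g + poly_fls q g"
  by (induction p q rule: poly_induct2) (simp_all add: algebra_simps fls_plus_const)

lemma poly_fls_diff: "poly_fls (p - q) g = poly_fls p g - poly_fls q g"
  using poly_fls_add[of "p - q" q g] by simp

lemma poly_fls_smult: "poly_fls (smult a p) g = fls_const a * poly_fls p g"
  by (induction p) (simp_all add: algebra_simps fls_const_mult_const)

lemma poly_fls_mult: "poly_fls (p * q) g = poly_fls p g * poly_fls q g"
  by (induction p) (simp_all add: algebra_simps poly_fls_add poly_fls_smult)

lemma fls_deriv_poly_fls: "fls_deriv (poly_fls p g) = poly_fls (pderiv p) g * fls_deriv g"
  by (induction p) (simp_all add: pderiv_pCons poly_fls_add algebra_simps)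

text \<open>As \<open>g\<close> has a simple pole, \<open>g ^ i\<close> has a pole of order exactly
  \<open>i\<close>. In degree \<open>d\<close>, the coefficient of \<open>X^(-d)\<close> is
  therefore the leading coefficient times the \<open>d\<close>-th power of the nonzero residue, and
  regularity forces \<open>d = 0\<close>.\<close>

lemma poly_fls_regular_imp_const:
  assumes g: "fls_subdegree g = -1" and reg: "\<And>m. m < 0 \<Longrightarrow> poly_fls p g $$ m = 0"
  shows "poly_fls p g = fls_const (coeff p 0)"
proof -
  have deg: "degree (map_poly fls_const p) = degree p"
    by (rule degree_map_poly) auto
  have exp: "poly_fls p g = (\<Sum>i\<le>degree p. fls_const (coeff p i) * g ^ i)"
    by (simp add: poly_fls_def poly_altdef deg coeff_map_poly)
  define d where "d = degree p"
  have "d = 0"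
  proof (rule ccontr)
    assume "d \<noteq> 0"
    have "poly_fls p g $$ (- int d) = (\<Sum>i\<le>d. coeff p i * (g ^ i) $$ (- int d))"
      by (simp add: exp d_def fls_nth_sum)
    also have "\<dots> = (\<Sum>i\<in>{d}. coeff p i * (g ^ i) $$ (- int d))"
      by (rule sum.mono_neutral_right) (auto simp: fls_pow_nth_below_subdegree g)
    also have "\<dots> = coeff p d * (g $$ (-1)) ^ d"
      using fls_pow_base[of g d] by (simp add: g)
    finally have "coeff p d * (g $$ (-1)) ^ d = 0"
      using reg[of "- int d"] \<open>d \<noteq> 0\<close> by simp
    moreover have "g $$ (-1) \<noteq> 0"
      using g nth_fls_subdegree_nonzero[of g] by fastforce
    ultimately show False
      using \<open>d \<noteq> 0\<close> by (auto simp: d_def)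
  qed
  then show ?thesis
    by (simp add: exp d_def)
qed

section \<open>The cotangent series and its divided derivatives\<close>

definition odd_coeffs :: "(nat \<Rightarrow> 'a :: zero) \<Rightarrow> nat \<Rightarrow> 'a" where
  "odd_coeffs z j = (if odd j then z ((j + 1) div 2) else 0)"

text \<open>For \<open>z k = zeta (2 * k)\<close> this is the expansion of \<open>- (pi / 2) * cot (pi * X)\<close>.\<close>

definition cot_fls :: "(nat \<Rightarrow> 'a :: field_char_0) \<Rightarrow> 'a fls" where
  "cot_fls z = fls_const (-1 / 2) * fls_X_inv + fps_to_fls (Abs_fps (odd_coeffs z))"

text \<open>The \<open>H r\<close> of the overview, for a general sequence \<open>z\<close>;
  dividing by \<open>fact r\<close> turns the factors produced by differentiation into
  binomials.\<close>

definition cot_fls_deriv :: "(nat \<Rightarrow> 'a :: field_char_0) \<Rightarrow> nat \<Rightarrow> 'a fls" where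
  "cot_fls_deriv z r = fls_const (1 / fact r) * (fls_deriv ^^ r) (cot_fls z)"

text \<open>The regular part of \<open>cot_fls_deriv z r\<close>, separated so that its square can
  be computed among power series.\<close>

definition cot_fps_deriv :: "(nat \<Rightarrow> 'a :: field_char_0) \<Rightarrow> nat \<Rightarrow> 'a fps" where
  "cot_fps_deriv z r = Abs_fps (\<lambda>i. of_nat ((i + r) choose r) * odd_coeffs z (i + r))"

lemma cot_fls_nth:
  "cot_fls z $$ m = (if m = -1 then -1 / 2 else if m < 0 then 0 else odd_coeffs z (nat m))"
  by (simp add: cot_fls_def)

lemma cot_fls_nth_nat: "cot_fls z $$ int i = odd_coeffs z i"
  by (simp add: cot_fls_nth)

lemma fps_to_fls_nth_nat: "fps_to_fls f $$ int i = f $ i"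
  by simp

lemma odd_coeffs_odd: "1 \<le> n \<Longrightarrow> odd_coeffs z (2 * n - 1) = z n"
  by (simp add: odd_coeffs_def)

text \<open>Differentiating \<open>r\<close> times turns the simple pole into a single term of order
  \<open>r + 1\<close> and annihilates the nonnegative powers below \<open>X^r\<close>, so no
  exponent strictly between \<open>-(r+1)\<close> and \<open>0\<close> occurs.\<close>

lemma cot_fls_deriv_eq:
  "cot_fls_deriv z r = fls_const (- ((-1) ^ r) / 2) * fls_X_inv ^ Suc r + fps_to_fls (cot_fps_deriv z r)"
proof (rule fls_eqI)
  fix m
  have L: "cot_fls_deriv z r $$ m = (of_int (m + int r) gchoose r) * cot_fls z $$ (m + int r)"
    by (simp add: cot_fls_deriv_def fls_deriv_iterate_nth)
  consider "m + int r = -1" | "m + int r < -1" | "m + int r \<ge> 0" "m < 0" | "m \<ge> 0"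
    by linarith
  then show "cot_fls_deriv z r $$ m = (fls_const (- ((-1) ^ r) / 2) * fls_X_inv ^ Suc r
      + fps_to_fls (cot_fps_deriv z r)) $$ m"
  proof cases
    case 1
    have "((-1 :: 'a) gchoose r) = (-1) ^ r"
      using gbinomial_minus[of "1 :: 'a" r] by (simp add: binomial_gbinomial[symmetric])
    moreover have "m = - 1 - int r" using 1 by simp
    ultimately show ?thesis
      unfolding L 1 by (simp add: cot_fls_nth del: power_Suc)
  next
    case 2
    then show ?thesis unfolding L by (simp add: cot_fls_nth del: power_Suc)
  next
    case 3
    define i where "i = nat (m + int r)"
    have i: "m + int r = int i" "i < r" using 3 by (auto simp: i_def)
    have "(of_int (m + int r) :: 'a) gchoose r = 0"
      unfolding i using i(2) by (simp flip: binomial_gbinomial)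
    then show ?thesis unfolding L using 3 by (simp del: power_Suc)
  next
    case 4
    then obtain i where i: "m = int i" using nonneg_int_cases by blast
    have "(of_int (m + int r) :: 'a) gchoose r = of_nat ((i + r) choose r)"
      unfolding i by (metis binomial_gbinomial of_int_of_nat_eq of_nat_add)
    then show ?thesis unfolding L by (simp add: i cot_fls_nth cot_fps_deriv_def nat_int_add del: power_Suc)
  qed
qed

lemma cot_fls_deriv_nth_neg:
  assumes "m < 0"
  shows "cot_fls_deriv z r $$ m = (if m = - int r - 1 then - ((-1) ^ r) / 2 else 0)"
  using assms by (simp add: cot_fls_deriv_eq del: power_Suc)

lemma cot_fls_deriv_nth_nonneg:
  "cot_fls_deriv z r $$ int i = of_nat ((i + r) choose r) * odd_coeffs z (i + r)"
  by (simp add: cot_fls_deriv_eq cot_fps_deriv_def del: power_Suc)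

text \<open>Square of a pole term plus a regular part: the pole coefficient
  \<open>c = -(-1)^r / 2\<close> has \<open>c^2 = 1/4\<close> and \<open>2c = -(-1)^r\<close>, and
  multiplying the regular part by \<open>X^(-(r+1))\<close> only shifts its coefficients.\<close>

lemma cot_fls_deriv_square_nth:
  "(cot_fls_deriv z r ^ 2) $$ m
    = (if m = - int (2 * Suc r) then 1 / 4 else 0)
      - (-1) ^ r * fps_to_fls (cot_fps_deriv z r) $$ (m + int (Suc r))
      + fps_to_fls (cot_fps_deriv z r * cot_fps_deriv z r) $$ m"
proof -
  define u where "u = fps_to_fls (cot_fps_deriv z r)"
  define c :: 'a where "c = - ((-1) ^ r) / 2"
  have c: "fls_const c * fls_const c = fls_const (1 / 4)" "fls_const c + fls_const c = - fls_const ((-1) ^ r)"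
    by (simp add: c_def fls_const_mult_const flip: power_add, rule fls_eqI, simp add: c_def)
  have "cot_fls_deriv z r ^ 2 = (fls_const c * fls_const c) * (fls_X_inv ^ Suc r * fls_X_inv ^ Suc r)
      + (fls_const c + fls_const c) * (fls_X_inv ^ Suc r * u) + u * u"
    unfolding cot_fls_deriv_eq u_def c_def by (simp add: power2_eq_square algebra_simps del: power_Suc)
  also have "fls_X_inv ^ Suc r * fls_X_inv ^ Suc r = (fls_X_inv ^ (2 * Suc r) :: 'a fls)"
    by (simp only: mult_2 power_add)
  finally show ?thesis
    unfolding c
    by (simp add: u_def fls_times_fps_to_fls fls_X_inv_power_times_conv_shift del: power_Suc mult_Suc_right)
qed

lemma odd_coeffs_convolution:
  "(\<Sum>j\<le>2 * n - 2. of_nat (j choose r) * odd_coeffs z j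
      * (of_nat ((2 * n - 2 - j) choose r) * odd_coeffs z (2 * n - 2 - j)))
    = (\<Sum>k=1..n-1. of_nat ((2 * k - 1) choose r) * of_nat ((2 * n - 2 * k - 1) choose r)
        * (z k * z (n - k)) :: 'a :: field_char_0)" (is "(\<Sum>j\<le>_. ?f j) = _")
proof -
  have "(\<Sum>j\<le>2 * n - 2. ?f j) = (\<Sum>k=1..n-1. ?f (2 * k - 1))"
    by (rule sum_odd_indices) (simp add: odd_coeffs_def)
  also have "\<dots> = (\<Sum>k=1..n-1. of_nat ((2 * k - 1) choose r) * of_nat ((2 * n - 2 * k - 1) choose r)
        * (z k * z (n - k)))"
  proof (rule sum.cong)
    fix k assume k: "k \<in> {1..n-1}"
    then have "2 * n - 2 - (2 * k - 1) = 2 * (n - k) - 1" "2 * n - 2 * k - 1 = 2 * (n - k) - 1"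
      "n - k \<ge> 1" "k < n"
      by auto
    then show "?f (2 * k - 1) = of_nat ((2 * k - 1) choose r) * of_nat ((2 * n - 2 * k - 1) choose r)
        * (z k * z (n - k))"
      using k by (simp add: odd_coeffs_def)
  qed simp
  finally show ?thesis .
qed

text \<open>Shifting both indices by \<open>r\<close> brings their total to
  \<open>2 * n - 2\<close>. The indices missing at either end may be added, because a binomial
  vanishes there.\<close>

lemma cot_fps_deriv_square_nth:
  assumes "r + 1 \<le> n"
  shows "(cot_fps_deriv z r * cot_fps_deriv z r) $ (2 * n - 2 * r - 2)
    = (\<Sum>k=1..n-1. of_nat ((2 * k - 1) choose r) * of_nat ((2 * n - 2 * k - 1) choose r)
        * (z k * z (n - k)))"
proof -
  define f where "f j = of_nat (j choose r) * odd_coeffs z j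
      * (of_nat ((2 * n - 2 - j) choose r) * odd_coeffs z (2 * n - 2 - j))" for j
  have "(cot_fps_deriv z r * cot_fps_deriv z r) $ (2 * n - 2 * r - 2)
      = (\<Sum>i=0..2 * n - 2 * r - 2. f (i + r))"
    unfolding fps_mult_nth
  proof (rule sum.cong)
    fix i assume "i \<in> {0..2 * n - 2 * r - 2}"
    then have "2 * n - 2 * r - 2 - i + r = 2 * n - 2 - (i + r)"
      using assms by auto
    then show "cot_fps_deriv z r $ i * cot_fps_deriv z r $ (2 * n - 2 * r - 2 - i) = f (i + r)"
      by (simp add: cot_fps_deriv_def f_def)
  qed simp
  also have "\<dots> = (\<Sum>j=r..2 * n - 2 - r. f j)"
    using assms by (intro sum.reindex_bij_witness[of _ "\<lambda>j. j - r" "\<lambda>i. i + r"]) auto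
  also have "\<dots> = (\<Sum>j\<le>2 * n - 2. f j)"
    by (rule sum.mono_neutral_left) (auto simp: f_def)
  finally show ?thesis
    unfolding f_def odd_coeffs_convolution .
qed

section \<open>Riccati equation and weighted convolution for sequences satisfying Euler's
  formula\<close>

context
  fixes z :: "nat \<Rightarrow> 'a :: field_char_0"
  assumes convolution:
    "\<And>n. 2 \<le> n \<Longrightarrow> (\<Sum>k=1..n-1. z k * z (n - k)) = (of_nat n + 1 / 2) * z n"
begin

text \<open>At \<open>X^(2n-2)\<close> with \<open>n >= 2\<close> the claim is
  \<open>(2n - 1) * z n = 2 * (- z n + (n + 1/2) * z n)\<close>, which is the convolution
  hypothesis. For \<open>n = 1\<close> the convolution is empty, and the constant
  \<open>3 * z 1\<close> makes up the difference. Odd exponents vanish by parity.\<close>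

lemma cot_fls_riccati: "fls_deriv (cot_fls z) = fls_const (3 * z 1) + fls_const 2 * cot_fls z ^ 2"
proof (rule fls_eqI)
  fix m
  define u where "u = cot_fps_deriv z 0"
  have sq: "(cot_fls z ^ 2) $$ m = (if m = - 2 then 1 / 4 else 0)
      - fps_to_fls u $$ (m + 1) + fps_to_fls (u * u) $$ m"
    using cot_fls_deriv_square_nth[of z 0 m] by (simp add: cot_fls_deriv_def u_def)
  have u: "u $ i = odd_coeffs z i" for i
    by (simp add: u_def cot_fps_deriv_def)
  have R: "(fls_const (3 * z 1) + fls_const 2 * cot_fls z ^ 2) $$ m
      = (if m = 0 then 3 * z 1 else 0) + 2 * ((if m = - 2 then 1 / 4 else 0)
      - fps_to_fls u $$ (m + 1) + fps_to_fls (u * u) $$ m)"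
    by (simp add: sq)
  have L: "fls_deriv (cot_fls z) $$ m = of_int (m + 1) * cot_fls z $$ (m + 1)"
    by simp
  consider "m < - 2" | "m = - 2" | "m = - 1" | i where "m = int i" "odd i"
    | n where "m = int (2 * n - 2)" "1 \<le> n"
  proof (cases "m < 0")
    case False
    then obtain i where "m = int i" using nonneg_int_cases by (metis not_less)
    moreover have "\<exists>n. i = 2 * n - 2 \<and> 1 \<le> n" if "even i"
      using that by (intro exI[of _ "i div 2 + 1"]) auto
    ultimately show ?thesis using that(4,5) by blast
  qed (use that(1-3) in linarith)
  then show "fls_deriv (cot_fls z) $$ m = (fls_const (3 * z 1) + fls_const 2 * cot_fls z ^ 2) $$ m"
  proof cases
    case (4 i)
    have "(u * u) $ i = 0"
      unfolding fps_mult_nth u using 4 by (intro sum.neutral) (auto simp: odd_coeffs_def)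
    then show ?thesis
      unfolding L R using 4 by (auto simp: cot_fls_nth u odd_coeffs_def nat_add_distrib)
  next
    case (5 n)
    have uu: "(u * u) $ (2 * n - 2) = (\<Sum>k=1..n-1. z k * z (n - k))"
      using cot_fps_deriv_square_nth[of 0 n z] 5 by (simp add: u_def)
    have e: "m + 1 = int (2 * n - 1)" "m = 0 \<longleftrightarrow> n = 1"
      using 5 by auto
    have o: "odd_coeffs z (2 * n - 1) = z n"
      using 5 by (simp add: odd_coeffs_def)
    have 1: "fls_deriv (cot_fls z) $$ m = (2 * of_nat n - 1) * z n"
      unfolding L e cot_fls_nth_nat o using 5 by (simp add: of_nat_diff)
    have 2: "(fls_const (3 * z 1) + fls_const 2 * cot_fls z ^ 2) $$ m
        = (if n = 1 then 3 * z 1 else 0) + 2 * (- z n + (\<Sum>k=1..n-1. z k * z (n - k)))"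
    proof -
      have "fps_to_fls u $$ (m + 1) = z n"
        unfolding e fps_to_fls_nth_nat u o ..
      moreover have "fps_to_fls (u * u) $$ m = (\<Sum>k=1..n-1. z k * z (n - k))"
        unfolding 5(1) fps_to_fls_nth_nat uu ..
      ultimately show ?thesis
        unfolding R e(2) using 5 by simp
    qed
    show ?thesis
    proof (cases "n = 1")
      case True
      then show ?thesis unfolding 1 2 by simp
    next
      case False
      then show ?thesis unfolding 1 2 using convolution[of n] 5 by (simp add: field_simps)
    qed
  qed (unfold L R, simp_all add: cot_fls_nth u odd_coeffs_def)
qed

text \<open>By the Riccati equation, differentiation sends \<open>p\<close> evaluated at the series
  to \<open>p' * q\<close> evaluated there, with \<open>q = 3 * z 1 + 2 * X^2\<close>.\<close>

lemma cot_fls_deriv_is_poly: "\<exists>p. cot_fls_deriv z r = poly_fls p (cot_fls z)"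
proof -
  have "\<exists>p. (fls_deriv ^^ r) (cot_fls z) = poly_fls p (cot_fls z)"
  proof (induction r)
    case 0
    show ?case by (intro exI[of _ "[:0, 1:]"]) simp
  next
    case (Suc r)
    then obtain p where p: "(fls_deriv ^^ r) (cot_fls z) = poly_fls p (cot_fls z)" by blast
    have "fls_deriv (cot_fls z) = poly_fls [:3 * z 1, 0, 2:] (cot_fls z)"
      by (simp add: cot_fls_riccati power2_eq_square mult_ac)
    then have "(fls_deriv ^^ Suc r) (cot_fls z) = poly_fls (pderiv p * [:3 * z 1, 0, 2:]) (cot_fls z)"
      by (simp only: p fls_deriv_poly_fls poly_fls_mult funpow.simps o_apply)
    then show ?case by blast
  qed
  then show ?thesis
    unfolding cot_fls_deriv_def by (metis poly_fls_smult)
qed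

text \<open>The coefficients are chosen to match principal parts, so that the difference
  \<open>D\<close> has no pole; being a polynomial in the cotangent series, \<open>D\<close> is then
  constant. The leading \<open>1/4\<close> comes from half of order \<open>2 * r + 1\<close>, and
  the cross term of the square fixes the others.\<close>

lemma cot_fls_deriv_square_linear:
  "\<exists>c. cot_fls_deriv z r ^ 2 = fls_const (1 / 2) * cot_fls_deriv z (2 * r + 1)
    - (\<Sum>k=1..r. fls_const (2 * (-1) ^ r * of_nat ((2 * k - 1) choose r) * z k)
        * cot_fls_deriv z (2 * r + 1 - 2 * k)) + fls_const c"
proof -
  define b where "b k = 2 * (-1) ^ r * of_nat ((2 * k - 1) choose r) * z k" for k
  define D where "D = cot_fls_deriv z r ^ 2 - fls_const (1 / 2) * cot_fls_deriv z (2 * r + 1)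
    + (\<Sum>k=1..r. fls_const (b k) * cot_fls_deriv z (2 * r + 1 - 2 * k))"
  obtain P where P: "\<And>r. cot_fls_deriv z r = poly_fls (P r) (cot_fls z)"
    using cot_fls_deriv_is_poly by metis
  have "\<exists>p. D = poly_fls p (cot_fls z)"
  proof
    have sum: "poly_fls (\<Sum>k\<in>A. f k) (cot_fls z) = (\<Sum>k\<in>A. poly_fls (f k) (cot_fls z))"
      for A :: "nat set" and f
      by (induction A rule: infinite_finite_induct) (simp_all add: poly_fls_add)
    show "D = poly_fls (P r * P r - smult (1 / 2) (P (2 * r + 1))
        + (\<Sum>k=1..r. smult (b k) (P (2 * r + 1 - 2 * k)))) (cot_fls z)"
      by (simp add: D_def P poly_fls_add poly_fls_mult poly_fls_diff poly_fls_smult sum power2_eq_square)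
  qed
  then obtain p where p: "D = poly_fls p (cot_fls z)" by blast
  have "D $$ m = 0" if m: "m < 0" for m
  proof -
    \<comment> \<open>The order \<open>2 * r + 1 - 2 * k\<close> is odd, so the pole coefficient is
      \<open>+1/2\<close>; this accounts for the factor \<open>2\<close> in
      \<open>b k\<close>.\<close>
    have "cot_fls_deriv z (2 * r + 1 - 2 * k) $$ m = (if m = 2 * int k - 2 * int r - 2 then 1 / 2 else 0)"
      if "k \<in> {1..r}" for k
    proof -
      have "2 * r + 1 - 2 * k = 2 * (r - k) + 1" using that by auto
      then show ?thesis
        using that m by (simp add: cot_fls_deriv_nth_neg of_nat_diff algebra_simps)
    qed
    then have "D $$ m = - ((-1) ^ r * fps_to_fls (cot_fps_deriv z r) $$ (m + int (Suc r)))
        + (\<Sum>k=1..r. b k * (if m = 2 * int k - 2 * int r - 2 then 1 / 2 else 0))"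
      using m by (simp add: D_def cot_fls_deriv_square_nth cot_fls_deriv_nth_neg fls_nth_sum)
    also have "\<dots> = 0"
    proof (cases "\<exists>k\<in>{1..r}. m = 2 * int k - 2 * int r - 2")
      case True
      then obtain k where k: "k \<in> {1..r}" "m = 2 * int k - 2 * int r - 2" by blast
      have "(\<Sum>k'=1..r. b k' * (if m = 2 * int k' - 2 * int r - 2 then 1 / 2 else 0))
          = (\<Sum>k'=1..r. if k' = k then b k / 2 else 0)"
        using k by (intro sum.cong) auto
      also have "\<dots> = b k / 2"
        using k by simp
      also have "\<dots> = (-1) ^ r * fps_to_fls (cot_fps_deriv z r) $$ (m + int (Suc r))"
      \<comment> \<open>For \<open>2 * k <= r\<close> the shifted index is negative, and the
        binomial in \<open>b k\<close> vanishes as well.\<close>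
      proof (cases "2 * k \<le> r")
        case True
        then have "2 * k - 1 < r"
          using k by auto
        then show ?thesis
          using True k by (simp add: b_def)
      next
        case False
        then have "m + int (Suc r) = int (2 * k - 1 - r)" "2 * k - 1 - r + r = 2 * k - 1"
          using k by auto
        then have "fps_to_fls (cot_fps_deriv z r) $$ (m + int (Suc r)) = of_nat ((2 * k - 1) choose r) * z k"
          using odd_coeffs_odd[of k z] k
          by (simp only: fps_to_fls_nth_nat cot_fps_deriv_def fps_nth_Abs_fps atLeastAtMost_iff)
        then show ?thesis
          by (simp add: b_def)
      qed
      finally show ?thesis by simp
    next
      case False
      \<comment> \<open>Only odd \<open>i + r\<close> carry a nonzero coefficient, and this makes
        \<open>m\<close> one of the excluded exponents.\<close>
      have "fps_to_fls (cot_fps_deriv z r) $$ (m + int (Suc r)) = 0"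
      proof (rule ccontr)
        assume nz: "fps_to_fls (cot_fps_deriv z r) $$ (m + int (Suc r)) \<noteq> 0"
        then have "0 \<le> m + int (Suc r)" by (auto split: if_splits)
        then obtain i where i: "m + int (Suc r) = int i" using nonneg_int_cases by blast
        then have "odd (i + r)"
          using nz by (auto simp: cot_fps_deriv_def odd_coeffs_def split: if_splits)
        then obtain q where "i + r = 2 * q + 1" by (rule oddE)
        then have "q + 1 \<in> {1..r}" "m = 2 * int (q + 1) - 2 * int r - 2"
          using i m by auto
        then show False using False by blast
      qed
      moreover have "(\<Sum>k=1..r. b k * (if m = 2 * int k - 2 * int r - 2 then 1 / 2 else 0)) = 0"
        using False by (intro sum.neutral) auto
      ultimately show ?thesis by simp
    qed
    finally show ?thesis .
  qed
  moreover have "fls_subdegree (cot_fls z) = - 1"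
    by (rule fls_subdegree_eqI) (auto simp: cot_fls_nth)
  ultimately have "D = fls_const (coeff p 0)"
    unfolding p by (intro poly_fls_regular_imp_const) auto
  then show ?thesis
    unfolding D_def b_def by (intro exI[of _ "coeff p 0"]) (simp add: algebra_simps)
qed

text \<open>Read off the coefficient of \<open>X^N\<close> with \<open>N = 2n - 2r - 2\<close> in
  the linear relation. Since \<open>n >= r + 2\<close> makes \<open>N\<close> positive, the
  undetermined constant does not enter. The cross term of the square, moved to the right, gives the
  multiple of \<open>(2n - 1) choose r\<close>.\<close>

theorem weighted_convolution:
  assumes "r + 2 \<le> n"
  shows "(\<Sum>k=1..n-1. of_nat ((2 * k - 1) choose r) * of_nat ((2 * n - 2 * k - 1) choose r)
      * (z k * z (n - k)))
    = (of_nat ((2 * n - 1) choose (2 * r + 1)) / 2 + (-1) ^ r * of_nat ((2 * n - 1) choose r)) * z n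
      - 2 * (-1) ^ r * (\<Sum>k=1..r. of_nat ((2 * k - 1) choose r)
          * of_nat ((2 * n - 2 * k - 1) choose (2 * r + 1 - 2 * k)) * (z k * z (n - k)))"
proof -
  define N where "N = 2 * n - 2 * r - 2"
  define b where "b k = 2 * (-1) ^ r * of_nat ((2 * k - 1) choose r) * z k" for k
  obtain c where "cot_fls_deriv z r ^ 2 = fls_const (1 / 2) * cot_fls_deriv z (2 * r + 1)
    - (\<Sum>k=1..r. fls_const (b k) * cot_fls_deriv z (2 * r + 1 - 2 * k)) + fls_const c"
    using cot_fls_deriv_square_linear[of r] unfolding b_def by blast
  from arg_cong[OF this, of "\<lambda>f. f $$ int N"]
  have "(cot_fls_deriv z r ^ 2) $$ int N = 1 / 2 * cot_fls_deriv z (2 * r + 1) $$ int N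
      - (\<Sum>k=1..r. b k * cot_fls_deriv z (2 * r + 1 - 2 * k) $$ int N)"
    using assms by (simp add: N_def fls_nth_sum)
  moreover have "(cot_fls_deriv z r ^ 2) $$ int N
      = (\<Sum>k=1..n-1. of_nat ((2 * k - 1) choose r) * of_nat ((2 * n - 2 * k - 1) choose r)
        * (z k * z (n - k))) - (-1) ^ r * of_nat ((2 * n - 1) choose r) * z n"
  proof -
    have "int N + int (Suc r) = int (N + Suc r)" "N + Suc r + r = 2 * n - 1"
      using assms by (auto simp: N_def)
    then have "fps_to_fls (cot_fps_deriv z r) $$ (int N + int (Suc r)) = of_nat ((2 * n - 1) choose r) * z n"
      using odd_coeffs_odd[of n z] assms
      by (simp only: fps_to_fls_nth_nat cot_fps_deriv_def fps_nth_Abs_fps)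
    moreover have "(cot_fps_deriv z r * cot_fps_deriv z r) $ N
      = (\<Sum>k=1..n-1. of_nat ((2 * k - 1) choose r) * of_nat ((2 * n - 2 * k - 1) choose r)
        * (z k * z (n - k)))"
      unfolding N_def using assms by (intro cot_fps_deriv_square_nth) simp
    ultimately show ?thesis
      unfolding cot_fls_deriv_square_nth by simp
  qed
  moreover have "cot_fls_deriv z (2 * r + 1) $$ int N = of_nat ((2 * n - 1) choose (2 * r + 1)) * z n"
  proof -
    have "N + (2 * r + 1) = 2 * n - 1" using assms by (auto simp: N_def)
    then show ?thesis
      using assms by (simp only: cot_fls_deriv_nth_nonneg) (simp add: odd_coeffs_def)
  qed
  moreover have "(\<Sum>k=1..r. b k * cot_fls_deriv z (2 * r + 1 - 2 * k) $$ int N)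
      = 2 * (-1) ^ r * (\<Sum>k=1..r. of_nat ((2 * k - 1) choose r)
          * of_nat ((2 * n - 2 * k - 1) choose (2 * r + 1 - 2 * k)) * (z k * z (n - k)))"
    unfolding sum_distrib_left
  proof (rule sum.cong)
    fix k assume k: "k \<in> {1..r}"
    then have "N + (2 * r + 1 - 2 * k) = 2 * (n - k) - 1" "2 * n - 2 * k - 1 = 2 * (n - k) - 1"
      "n - k \<ge> 1" "k < n"
      using assms by (auto simp: N_def)
    then show "b k * cot_fls_deriv z (2 * r + 1 - 2 * k) $$ int N
        = 2 * (-1) ^ r * (of_nat ((2 * k - 1) choose r)
          * of_nat ((2 * n - 2 * k - 1) choose (2 * r + 1 - 2 * k)) * (z k * z (n - k)))"
      by (simp only: cot_fls_deriv_nth_nonneg) (simp add: odd_coeffs_def b_def)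
  qed simp
  ultimately have "(\<Sum>k=1..n-1. of_nat ((2 * k - 1) choose r) * of_nat ((2 * n - 2 * k - 1) choose r)
        * (z k * z (n - k))) - (-1) ^ r * of_nat ((2 * n - 1) choose r) * z n
      = 1 / 2 * (of_nat ((2 * n - 1) choose (2 * r + 1)) * z n)
        - 2 * (-1) ^ r * (\<Sum>k=1..r. of_nat ((2 * k - 1) choose r)
          * of_nat ((2 * n - 2 * k - 1) choose (2 * r + 1 - 2 * k)) * (z k * z (n - k)))"
    by (simp only:)
  then show ?thesis
    by (simp only: diff_eq_eq) (simp add: distrib_right)
qed

end

section \<open>The weighted sum formula\<close>

text \<open>Reflection exchanges the outer blocks \<open>1..r\<close> and \<open>n-r..n-1\<close>;
  the bound on \<open>n\<close> keeps the three blocks disjoint.\<close>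

lemma sum_symmetric_split:
  fixes g :: "nat \<Rightarrow> 'a :: comm_ring_1"
  assumes "2 * r + 1 \<le> n" and sym: "\<And>k. k \<in> {1..n-1} \<Longrightarrow> g (n - k) = g k"
  shows "(\<Sum>k=1..n-1. g k) = 2 * (\<Sum>k=1..r. g k) + (\<Sum>k=r+1..n-r-1. g k)"
proof -
  have split: "{1..n-1} = ({1..r} \<union> {r+1..n-r-1}) \<union> {n-r..n-1}"
    using assms(1) by auto
  have "(\<Sum>k=1..n-1. g k) = (\<Sum>k=1..r. g k) + (\<Sum>k=r+1..n-r-1. g k) + (\<Sum>k=n-r..n-1. g k)"
    unfolding split using assms(1) by (subst sum.union_disjoint; (auto; fail)?)+
  also have "(\<Sum>k=n-r..n-1. g k) = (\<Sum>k=1..r. g k)"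
    using assms by (intro sum.reindex_bij_witness[of _ "\<lambda>k. n - k" "\<lambda>k. n - k"]) auto
  finally show ?thesis by simp
qed

text \<open>The offset \<open>d\<close> covers two uses: \<open>d = 0\<close> for the weights, and
  \<open>d = 2 * k\<close> for the product over \<beta> in the factored coefficients.\<close>

lemma prod_diff_eq_fact_mult_choose:
  "(\<Prod>\<alpha>=Suc d..d+r. of_nat (Suc (m + d)) - of_nat \<alpha>) = fact r * (of_nat (m choose r) :: 'a :: field_char_0)"
proof -
  have "fact r * (of_nat (m choose r) :: 'a) = (\<Prod>i=0..<r. of_nat m - of_nat i)"
    by (simp add: binomial_gbinomial gbinomial_prod_rev)
  also have "\<dots> = (\<Prod>\<alpha>=Suc d..d+r. of_nat (Suc (m + d)) - of_nat \<alpha>)"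
    by (rule prod.reindex_bij_witness[of _ "\<lambda>\<alpha>. \<alpha> - Suc d" "\<lambda>i. i + Suc d"]) auto
  finally show ?thesis ..
qed

section \<open>Coefficient polynomials, built from the binomials of \<open>a + b * x\<close> over
  \<open>r\<close>\<close>

definition choose_poly :: "rat \<Rightarrow> rat \<Rightarrow> nat \<Rightarrow> rat poly" where
  "choose_poly a b r = smult (1 / fact r) (\<Prod>i<r. [:a - of_nat i, b:])"

lemma degree_choose_poly: "degree (choose_poly a b r) \<le> r"
proof -
  have "degree (\<Prod>i<r. [:a - of_nat i, b:]) \<le> (\<Sum>i<r. degree [:a - of_nat i, b:])"
    using degree_prod_sum_le[of "{..<r}" "\<lambda>i. [:a - of_nat i, b:]"] by (simp add: o_def)
  also have "\<dots> \<le> (\<Sum>i<r. 1)"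
    by (rule sum_mono) simp
  finally show ?thesis
    by (simp add: choose_poly_def)
qed

lemma poly_choose_poly:
  assumes "a + b * x = of_nat m"
  shows "poly (choose_poly a b r) x = of_nat (m choose r)"
proof -
  have "a - of_nat i + x * b = of_nat m - of_nat i" for i
    using assms by (simp add: algebra_simps)
  then have "(\<Prod>i<r. a - of_nat i + x * b) = (\<Prod>i<r. of_nat m - of_nat i)"
    by (simp only:)
  then show ?thesis
    by (simp add: choose_poly_def poly_prod binomial_gbinomial gbinomial_prod_rev atLeast0LessThan)
qed

text \<open>For \<open>k > 0\<close> the two terms keep the form in which they arise: the first from
  removing the outer blocks of the symmetric sum, the second from
  \<open>weighted_convolution\<close>. The factored form is derived from this.\<close>

definition weighted_coeff :: "nat \<Rightarrow> nat \<Rightarrow> rat poly" where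
  "weighted_coeff r k =
    (if k = 0 then smult ((fact r)\<^sup>2) (smult ((-1) ^ r / 2) (choose_poly (-1) 2 r)
       + smult (1 / 4) (smult ((-1) ^ r) (choose_poly (-1) 1 r)
         + smult 4 (\<Sum>j=1..r. smult (of_nat ((2 * j - 1) choose r)) (choose_poly (- of_nat (2 * j + 1)) 2 r))))
     else smult (- ((fact r)\<^sup>2 * of_nat ((2 * k - 1) choose r)))
       (choose_poly (- of_nat (2 * k + 1)) 2 r
         + smult ((-1) ^ r) (choose_poly (- of_nat (2 * k + 1)) 2 (2 * r + 1 - 2 * k))))"

text \<open>The only critical degree is \<open>2 * r + 1 - 2 * k\<close>, which is at most
  \<open>r\<close> once \<open>2 * k > r\<close>. For smaller positive \<open>k\<close> the factor
  \<open>(2 * k - 1) choose r\<close> is zero.\<close>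

lemma degree_weighted_coeff: "degree (weighted_coeff r k) \<le> r"
proof (cases "k = 0 \<or> r < 2 * k")
  case True
  then show ?thesis
    unfolding weighted_coeff_def
    by (auto intro!: order.trans[OF degree_smult_le] degree_add_le degree_sum_le degree_choose_poly
        order.trans[OF degree_choose_poly])
next
  case False
  then have "2 * k - 1 < r"
    by auto
  then show ?thesis
    using False by (simp add: weighted_coeff_def)
qed

lemma poly_weighted_coeff_0:
  assumes "r + 1 \<le> n"
  shows "poly (weighted_coeff r 0) (of_nat n)
    = (fact r)\<^sup>2 * ((-1) ^ r / 2 * of_nat ((2 * n - 1) choose r) + 1 / 4 * phi r n)"
proof -
  have "poly (choose_poly (-1) 2 r) (of_nat n) = of_nat ((2 * n - 1) choose r)"
    "poly (choose_poly (-1) 1 r) (of_nat n) = of_nat ((n - 1) choose r)"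
    using assms by (auto intro!: poly_choose_poly simp: of_nat_diff)
  moreover have "poly (choose_poly (- of_nat (2 * j + 1)) 2 r) (of_nat n) = of_nat ((2 * n - 2 * j - 1) choose r)"
    if "j \<in> {1..r}" for j
    using assms that by (intro poly_choose_poly) (auto simp: of_nat_diff)
  ultimately show ?thesis
    by (simp add: weighted_coeff_def poly_sum phi_def)
qed

lemma poly_weighted_coeff_pos:
  assumes "1 \<le> k" "k \<le> r" "r + 1 \<le> n"
  shows "poly (weighted_coeff r k) (of_nat n)
    = - ((fact r)\<^sup>2 * of_nat ((2 * k - 1) choose r)
        * (of_nat ((2 * n - 2 * k - 1) choose r)
          + (-1) ^ r * of_nat ((2 * n - 2 * k - 1) choose (2 * r + 1 - 2 * k))))"
proof -
  have "poly (choose_poly (- of_nat (2 * k + 1)) 2 s) (of_nat n) = of_nat ((2 * n - 2 * k - 1) choose s)" for s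
    using assms by (intro poly_choose_poly) (auto simp: of_nat_diff)
  then show ?thesis
    using assms by (simp add: weighted_coeff_def algebra_simps)
qed

text \<open>Either \<open>2 * k <= r\<close> and \<open>(2 * k - 1) choose r\<close> vanishes, or
  \<open>2 * k = r + 1\<close>; then \<open>r\<close> is odd and
  \<open>2 * r + 1 - 2 * k = r\<close>, so the two binomial polynomials cancel.\<close>

lemma weighted_coeff_eq_0:
  assumes "1 \<le> k" "2 * k \<le> r + 1"
  shows "weighted_coeff r k = 0"
proof (cases "2 * k \<le> r")
  case True
  then have "2 * k - 1 < r"
    using assms by auto
  then show ?thesis
    using assms by (simp add: weighted_coeff_def)
next
  case False
  then have "2 * k = r + 1" using assms by simp
  then have "2 * r + 1 - 2 * k = r" "odd r"
    by (auto, presburger)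
  then show ?thesis
    using assms by (simp add: weighted_coeff_def)
qed

text \<open>With \<open>m\<close> and \<open>l\<close> as below, the falling factorial
  \<open>m! / (m-l)!\<close> is pulled out of both binomials;
  \<open>r! * (m choose r) = m! / (m-r)!\<close> then leaves the quotient
  \<open>(m-l)! / (m-r)!\<close>.\<close>

lemma poly_weighted_coeff_factored:
  assumes "r + 1 \<le> 2 * k" "k \<le> r" "2 * r + 2 \<le> n"
  shows "poly (weighted_coeff r k) (of_nat n) =
            - (\<Prod>\<alpha>=1..r. 2 * of_nat k - of_nat \<alpha>)
            * (\<Prod>\<beta>=2*k+1..2*r+1. 2 * of_nat n - of_nat \<beta>)
            * ((-1) ^ r * fact r / fact (2 * r - 2 * k + 1)
               + fact (2 * n - 2 * r - 2) / fact (2 * n - 2 * k - r - 1))"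
proof -
  define m l where "m = 2 * n - 2 * k - 1" and "l = 2 * r + 1 - 2 * k"
  have k: "1 \<le> k" using assms by simp
  have ml: "r \<le> m" "l \<le> m" "m - l = 2 * n - 2 * r - 2" "m - r = 2 * n - 2 * k - r - 1"
    "2 * r - 2 * k + 1 = l" "2 * k + l = 2 * r + 1" "Suc (m + 2 * k) = 2 * n"
    using assms k by (auto simp: m_def l_def)
  have p1: "(\<Prod>\<alpha>=1..r. 2 * of_nat k - of_nat \<alpha>) = fact r * (of_nat ((2 * k - 1) choose r) :: rat)"
    using prod_diff_eq_fact_mult_choose[where d = 0 and r = r and m = "2 * k - 1" and 'a = rat] k by simp
  have p2: "(\<Prod>\<beta>=2*k+1..2*r+1. 2 * of_nat n - of_nat \<beta>) = fact l * (of_nat (m choose l) :: rat)"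
    using prod_diff_eq_fact_mult_choose[where d = "2 * k" and r = l and m = m and 'a = rat] ml by simp
  have b1: "fact l * (of_nat (m choose l) :: rat) = fact m / fact (m - l)"
    and b2: "fact r * (of_nat (m choose r) :: rat) = fact m / fact (m - r)"
    using ml by (simp_all add: binomial_fact)
  have "fact l * of_nat (m choose l) * ((-1) ^ r * fact r / fact l + fact (m - l) / fact (m - r))
      = fact r * ((-1) ^ r * of_nat (m choose l)) + (fact m / fact (m - l)) * (fact (m - l) / fact (m - r) :: rat)"
    unfolding b1[symmetric] by (simp add: algebra_simps)
  also have "\<dots> = fact r * (of_nat (m choose r) + (-1) ^ r * of_nat (m choose l))"
    by (simp add: b2 algebra_simps)
  finally have main: "fact l * of_nat (m choose l) * ((-1) ^ r * fact r / fact l + fact (m - l) / fact (m - r))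
      = fact r * (of_nat (m choose r) + (-1) ^ r * (of_nat (m choose l) :: rat))" .
  have "poly (weighted_coeff r k) (of_nat n) = - (fact r * of_nat ((2 * k - 1) choose r))
      * (fact r * (of_nat (m choose r) + (-1) ^ r * of_nat (m choose l)))"
    using assms k by (simp add: poly_weighted_coeff_pos m_def l_def power2_eq_square)
  also have "\<dots> = - (fact r * of_nat ((2 * k - 1) choose r)) * (fact l * of_nat (m choose l)
      * ((-1) ^ r * fact r / fact l + fact (m - l) / fact (m - r)))"
    by (simp only: main)
  finally show ?thesis
    unfolding p1 p2 ml(5) ml(3,4)[symmetric] by (simp only: mult.assoc)
qed

section \<open>Assembly of the weighted sum formula\<close>

lemma weighted_double_zeta_sum:
  assumes "1 \<le> r" "2 * r + 2 \<le> n"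
  shows "(\<Sum>k=r+1..n-r-1. double_zeta (2 * k) (2 * n - 2 * k) *
          (\<Prod>\<alpha>=1..r. (2 * real k - real \<alpha>) * (2 * real n - 2 * real k - real \<alpha>)))
       = of_rat (poly (weighted_coeff r 0) (of_nat n)) * zeta (2 * n)
         + (\<Sum>k=1..r. of_rat (poly (weighted_coeff r k) (of_nat n)) * (zeta (2 * k) * zeta (2 * n - 2 * k)))"
proof -
  define f :: "nat \<Rightarrow> real" where
    "f k = of_nat ((2 * k - 1) choose r) * of_nat ((2 * n - 2 * k - 1) choose r)" for k
  define h :: "nat \<Rightarrow> real" where
    "h k = of_nat ((2 * k - 1) choose r) * of_nat ((2 * n - 2 * k - 1) choose (2 * r + 1 - 2 * k))" for k
  define y where "y k = zeta (2 * k) * zeta (2 * n - 2 * k)" for k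
  define T F where "T = (\<Sum>k=r+1..n-r-1. f k * double_zeta (2 * k) (2 * n - 2 * k))"
    and "F = (\<Sum>k=r+1..n-r-1. f k)"
  have sym: "f (n - k) = f k" "y (n - k) = y k" if "k \<in> {1..n-1}" for k
  proof -
    have "2 * n - 2 * (n - k) = 2 * k" "2 * n - 2 * k = 2 * (n - k)"
      using that by auto
    then show "f (n - k) = f k" "y (n - k) = y k"
      by (simp_all add: f_def y_def mult.commute)
  qed
  have lhs: "(\<Sum>k=r+1..n-r-1. double_zeta (2 * k) (2 * n - 2 * k) *
          (\<Prod>\<alpha>=1..r. (2 * real k - real \<alpha>) * (2 * real n - 2 * real k - real \<alpha>))) = (fact r)\<^sup>2 * T"
    unfolding T_def sum_distrib_left
  proof (rule sum.cong)
    fix k assume k: "k \<in> {r+1..n-r-1}"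
    have "(\<Prod>\<alpha>=1..r. 2 * real k - real \<alpha>) = fact r * real ((2 * k - 1) choose r)"
      using prod_diff_eq_fact_mult_choose[where d = 0 and r = r and m = "2 * k - 1" and 'a = real] k by simp
    moreover have "(\<Prod>\<alpha>=1..r. 2 * real n - 2 * real k - real \<alpha>) = fact r * real ((2 * n - 2 * k - 1) choose r)"
    proof -
      have "real (Suc (2 * n - 2 * k - 1 + 0)) = 2 * real n - 2 * real k"
        using k by (auto simp: of_nat_diff)
      then show ?thesis
        using prod_diff_eq_fact_mult_choose[where d = 0 and r = r and m = "2 * n - 2 * k - 1" and 'a = real] by simp
    qed
    ultimately show "double_zeta (2 * k) (2 * n - 2 * k) *
          (\<Prod>\<alpha>=1..r. (2 * real k - real \<alpha>) * (2 * real n - 2 * real k - real \<alpha>))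
        = (fact r)\<^sup>2 * (f k * double_zeta (2 * k) (2 * n - 2 * k))"
      by (simp add: prod.distrib f_def power2_eq_square)
  qed simp
  \<comment> \<open>Reflection swaps the arguments of the double zeta value and fixes the weight, so
    \<open>2 * T\<close> consists of symmetrised values to which the harmonic product
    applies.\<close>
  have "T = (\<Sum>k=r+1..n-r-1. f k * double_zeta (2 * n - 2 * k) (2 * k))"
    unfolding T_def
  proof (rule sum.reindex_bij_witness[of _ "\<lambda>k. n - k" "\<lambda>k. n - k"])
    fix k assume k: "k \<in> {r+1..n-r-1}"
    then have "2 * n - 2 * (n - k) = 2 * k" "2 * (n - k) = 2 * n - 2 * k" "k \<in> {1..n-1}"
      by auto
    then show "f (n - k) * double_zeta (2 * n - 2 * (n - k)) (2 * (n - k))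
        = f k * double_zeta (2 * k) (2 * n - 2 * k)"
      using sym(1) by simp
  qed (use assms in auto)
  then have "2 * T = (\<Sum>k=r+1..n-r-1. f k * (double_zeta (2 * k) (2 * n - 2 * k) + double_zeta (2 * n - 2 * k) (2 * k)))"
    by (simp add: T_def distrib_left sum.distrib)
  also have "\<dots> = (\<Sum>k=r+1..n-r-1. f k * y k - f k * zeta (2 * n))"
  proof (rule sum.cong)
    fix k assume k: "k \<in> {r+1..n-r-1}"
    then have "2 \<le> 2 * k" "2 \<le> 2 * n - 2 * k" "2 * k + (2 * n - 2 * k) = 2 * n"
      by auto
    then have "y k = double_zeta (2 * k) (2 * n - 2 * k) + double_zeta (2 * n - 2 * k) (2 * k) + zeta (2 * n)"
      unfolding y_def by (simp only: zeta_mult_zeta_eq_double_zeta)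
    then show "f k * (double_zeta (2 * k) (2 * n - 2 * k) + double_zeta (2 * n - 2 * k) (2 * k))
        = f k * y k - f k * zeta (2 * n)"
      by (simp add: algebra_simps)
  qed simp
  finally have T: "2 * T = (\<Sum>k=r+1..n-r-1. f k * y k) - F * zeta (2 * n)"
    by (simp add: F_def sum_subtractf sum_distrib_right)
  have "(\<Sum>k=1..m-1. zeta (2 * k) * zeta (2 * (m - k))) = (of_nat m + 1 / 2) * zeta (2 * m)"
    if "2 \<le> m" for m
    using sum_zeta_even_mult_zeta_even[OF that] by (simp add: diff_mult_distrib2)
  from weighted_convolution[of "\<lambda>k. zeta (2 * k)", OF this, of r n]
  have W: "(\<Sum>k=1..n-1. f k * y k)
      = (of_nat ((2 * n - 1) choose (2 * r + 1)) / 2 + (-1) ^ r * of_nat ((2 * n - 1) choose r)) * zeta (2 * n)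
      - 2 * (-1) ^ r * (\<Sum>k=1..r. h k * y k)"
    using assms by (simp add: f_def h_def y_def diff_mult_distrib2)
  \<comment> \<open>\<open>T\<close> involves only the middle block, so the outer terms are split
    off the full convolution; the same split of the bare weights determines
    \<open>F\<close>.\<close>
  have S: "(\<Sum>k=1..n-1. f k * y k) = 2 * (\<Sum>k=1..r. f k * y k) + (\<Sum>k=r+1..n-r-1. f k * y k)"
    using assms by (intro sum_symmetric_split) (auto simp: sym)
  have "(\<Sum>k=1..n-1. f k) = 2 * (\<Sum>k=1..r. f k) + F"
    unfolding F_def using assms by (intro sum_symmetric_split) (auto simp: sym)
  moreover have "2 * (\<Sum>k=1..n-1. f k)
      = of_nat ((2 * n - 1) choose (2 * r + 1)) - (-1) ^ r * of_nat ((n - 1) choose r)"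
    using arg_cong[OF sum_odd_choose_mult_choose[of n r], of real_of_int] assms by (simp add: f_def)
  \<comment> \<open>This is the second expression for \<open>phi\<close>, with the middle block of
    weights in place of the outer one.\<close>
  ultimately have phi: "of_rat (phi r n) = of_nat ((2 * n - 1) choose (2 * r + 1)) - 2 * F"
    by (simp add: phi_def f_def of_rat_add of_rat_mult of_rat_sum of_rat_power)
  have fact_rat: "of_rat (fact r) = (fact r :: real)"
    by (metis of_nat_fact of_rat_of_nat_eq)
  have c0: "of_rat (poly (weighted_coeff r 0) (of_nat n)) = (fact r)\<^sup>2
      * ((-1) ^ r / 2 * of_nat ((2 * n - 1) choose r) + 1 / 4 * (of_nat ((2 * n - 1) choose (2 * r + 1)) - 2 * F))"
    using assms by (simp add: poly_weighted_coeff_0 of_rat_add of_rat_mult of_rat_power of_rat_divide phi fact_rat)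
  have ck: "of_rat (poly (weighted_coeff r k) (of_nat n)) = - ((fact r)\<^sup>2 * (f k + (-1) ^ r * h k))"
    if "k \<in> {1..r}" for k
    using that assms
    by (simp add: poly_weighted_coeff_pos of_rat_add of_rat_mult of_rat_power of_rat_minus fact_rat f_def h_def)
       (simp add: algebra_simps)
  have "(\<Sum>k=1..r. of_rat (poly (weighted_coeff r k) (of_nat n)) * (zeta (2 * k) * zeta (2 * n - 2 * k)))
      = (\<Sum>k=1..r. - ((fact r)\<^sup>2 * (f k * y k + (-1) ^ r * (h k * y k))))"
    by (intro sum.cong) (auto simp: ck y_def algebra_simps)
  also have "\<dots> = - ((fact r)\<^sup>2 * ((\<Sum>k=1..r. f k * y k) + (-1) ^ r * (\<Sum>k=1..r. h k * y k)))"
    by (simp only: sum_negf sum.distrib flip: sum_distrib_left)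
  finally have rhs: "(\<Sum>k=1..r. of_rat (poly (weighted_coeff r k) (of_nat n)) * (zeta (2 * k) * zeta (2 * n - 2 * k)))
      = - ((fact r)\<^sup>2 * ((\<Sum>k=1..r. f k * y k) + (-1) ^ r * (\<Sum>k=1..r. h k * y k)))" .
  \<comment> \<open>After naming these five quantities, what remains is linear arithmetic combining
    the harmonic product, the convolution and the split.\<close>
  define A B P Q R where "A = (\<Sum>k=1..r. f k * y k)" and "B = (-1) ^ r * (\<Sum>k=1..r. h k * y k)"
    and "P = real ((2 * n - 1) choose (2 * r + 1))" and "Q = (-1) ^ r * real ((2 * n - 1) choose r)"
    and "R = zeta (2 * n)"
  have "2 * T = (P / 2 + Q) * R - 2 * B - 2 * A - F * R"
    using T W S unfolding A_def B_def P_def Q_def R_def by simp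
  then have T_eq: "T = (Q / 2 + 1 / 4 * (P - 2 * F)) * R - (A + B)"
    by (simp add: field_simps)
  have c0': "of_rat (poly (weighted_coeff r 0) (of_nat n)) = (fact r)\<^sup>2 * (Q / 2 + 1 / 4 * (P - 2 * F))"
    by (simp add: c0 P_def Q_def)
  have rhs': "(\<Sum>k=1..r. of_rat (poly (weighted_coeff r k) (of_nat n)) * (zeta (2 * k) * zeta (2 * n - 2 * k)))
      = - ((fact r)\<^sup>2 * (A + B))"
    by (simp only: rhs A_def B_def)
  show ?thesis
    unfolding lhs rhs' c0' R_def[symmetric] unfolding T_eq
    by (simp add: right_diff_distrib mult.assoc)
qed

theorem theorem3p6:
  fixes r :: nat
  assumes "r > 0"
  shows "\<exists>c :: nat \<Rightarrow> rat poly.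
    (\<forall>k\<le>r. degree (c k) \<le> r) \<and>
    (\<forall>n\<ge>2 * r + 2.
       (\<Sum>k=r+1..n-r-1. double_zeta (2 * k) (2 * n - 2 * k) *
          (\<Prod>\<alpha>=1..r. (2 * real k - real \<alpha>) * (2 * real n - 2 * real k - real \<alpha>)))
       = of_rat (poly (c 0) (of_nat n)) * zeta (2 * n)
         + (\<Sum>k=1..r. of_rat (poly (c k) (of_nat n)) * (zeta (2 * k) * zeta (2 * n - 2 * k)))) \<and>
    (\<forall>k. 1 \<le> k \<and> int k \<le> \<lceil>real r / 2\<rceil> \<longrightarrow> c k = 0) \<and>
    (\<forall>n\<ge>2 * r + 2.
       poly (c 0) (of_nat n) =
         (fact r)\<^sup>2 * ((-1) ^ r / 2 * of_nat ((2 * n - 1) choose r) + 1 / 4 * phi r n)) \<and>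
    (\<forall>k. \<lceil>real r / 2\<rceil> < int k \<and> k \<le> r \<longrightarrow>
       (\<forall>n\<ge>2 * r + 2.
          poly (c k) (of_nat n) =
            - (\<Prod>\<alpha>=1..r. 2 * of_nat k - of_nat \<alpha>)
            * (\<Prod>\<beta>=2*k+1..2*r+1. 2 * of_nat n - of_nat \<beta>)
            * ((-1) ^ r * fact r / fact (2 * r - 2 * k + 1)
               + fact (2 * n - 2 * r - 2) / fact (2 * n - 2 * k - r - 1))))"
proof (intro exI[of _ "weighted_coeff r"] conjI allI impI)
  fix k n assume "\<lceil>real r / 2\<rceil> < int k \<and> k \<le> r" "2 * r + 2 \<le> n"
  moreover from this have "r + 1 \<le> 2 * k"
    by linarith
  ultimately show "poly (weighted_coeff r k) (of_nat n) =
            - (\<Prod>\<alpha>=1..r. 2 * of_nat k - of_nat \<alpha>)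
            * (\<Prod>\<beta>=2*k+1..2*r+1. 2 * of_nat n - of_nat \<beta>)
            * ((-1) ^ r * fact r / fact (2 * r - 2 * k + 1)
               + fact (2 * n - 2 * r - 2) / fact (2 * n - 2 * k - r - 1))"
    by (intro poly_weighted_coeff_factored) auto
next
  fix k assume k: "1 \<le> k \<and> int k \<le> \<lceil>real r / 2\<rceil>"
  \<comment> \<open>Equality occurs for odd \<open>r\<close> with \<open>k\<close> equal to the
    ceiling, the case in which the two binomials cancel.\<close>
  then have "2 * k \<le> r + 1"
    by linarith
  then show "weighted_coeff r k = 0"
    using k by (intro weighted_coeff_eq_0) auto
qed (use assms in \<open>simp_all only: degree_weighted_coeff poly_weighted_coeff_0 weighted_double_zeta_sum\<close>)

end
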